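(* Let $0\le\gamma\le 1$. The function $\Theta: C^{\gamma}\to V$ that sends each potential $\psi\in C^{\gamma}$ to the Ruelle operator $\Theta(\psi)=\mathscr{L}_{\psi}\in V$ associated to $\psi$ is an analytic function on $C^\gamma$.
   Context: Let $(M,d)$ be a compact metric space equipped with a finite measure $\mu$ on its Borel sets. Let $\mathcal{B}$ be the set of all sequences $x=(x_0,x_1,\ldots)$ with $x_i\in M$, $i \in \mathbb{N}=\{0,1,2,\dots\}$, equipped, for a fixed $c>1$, with the distance $d_c(x,y)=\sum_{k\ge 0} d(x_k,y_k)/c^k$ (this induces the product topology, so $\mathcal{B}$ is compact). The space $C^\gamma=C^\gamma(\mathcal{B},\mathbb{R})$ and its norm $|\cdot|_\gamma$ are defined as follows. For $\gamma=0$, $C^0$ is the set of continuous functions $\mathcal{B}\to\mathbb{R}$ with $|\varphi|_0=\sup_{x\in\mathcal{B}}|\varphi(x)|$. For $0<\gamma\le 1$, $C^\gamma$ is the set of functions $\varphi:\mathcal{B}\to\mathbb{R}$ with $\mathrm{Hol}_\varphi=\sup_{x\ne y}\frac{|\varphi(y)-\varphi(x)|}{d_c(x,y)^{\gamma}}<\infty$, with norm $|\varphi|_\gamma=|\varphi|_0+\mathrm{Hol}_\varphi$. In each case $C^\gamma$ is a Banach space. For $\psi\in C^\gamma$, the Ruelle operator $\mathscr{L}_\psi:C^\gamma\to C^\gamma$ is $$\mathscr{L}_\psi(\varphi)(x)=\int_M e^{\psi(ax)}\varphi(ax)\,d\mu(a),\qquad \varphi\in C^\gamma,\ x\in\mathcal{B},$$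 where $ax=(a,x_0,x_1,\ldots)$ for $a\in M$. $V$ denotes the Banach space of all continuous linear maps $l:C^\gamma\to C^\gamma$ with the operator norm $|l|_V=\sup_{|\varphi|_\gamma\le 1}|l(\varphi)|_\gamma$. Analyticity: let $X,Y$ be Banach spaces, $U\subseteq X$ open and $F:U\to Y$; put $D^0F=F$. For $k\in\mathbb{N}$, $k\ge 1$, $F$ is $k$-differentiable at $x\in U$ if for each $j\in\{1,\ldots,k\}$ there is a bounded $j$-linear map $D^jF(x):X^j\to Y$ such that $$D^{j-1}F(x+v_j)(v_1,\ldots,v_{j-1})-D^{j-1}F(x)(v_1,\ldots,v_{j-1})=D^jF(x)(v_1,\ldots,v_j)+o_j(v_j),$$ where (for $v_1,\ldots,v_{j-1}$ fixed) $\lim_{v\to 0}\|o_j(v)\|_Y/\|v\|_X=0$. $F$ has derivatives of all orders in $U$ if it is $k$-differentiable at every $x\in U$ for every $k$. $F$ is analytic on $U$ if it has derivatives of all orders in $U$ and every $x\in U$ has an open neighborhood $U_x\subseteq U$ such that for all $v$ with $x+v\in U_x$, $$F(x+v)-F(x)=\sum_{j=1}^{\infty}\frac{1}{j!}D^jF(x)v^j,\qquad D^jF(x)v^j=D^jF(x)(v,\ldots,v).$$ *)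

theory Defs
  imports "HOL-Analysis.Analysis" "HOL-Library.Function_Algebras"
begin

section \<open>Function spaces as real vector spaces\<close>

instantiation "fun" :: (type, real_vector) real_vector
begin

definition scaleR_fun_def: "r *\<^sub>R f = (\<lambda>x. r *\<^sub>R f x)"

instance
  by standard
    (simp_all add: scaleR_fun_def fun_eq_iff scaleR_add_right scaleR_add_left)

end


section \<open>Normed spaces given by a carrier set\<close>

text \<open>
  The space of Hoelder functions depends on the real number \<open>\<gamma>\<close>, so it cannot be a type. A normed
  space is therefore a linear subspace \<open>pts\<close> of an ambient real vector space together with a
  norm \<open>nrm\<close>, whose values outside \<open>pts\<close> are irrelevant.
\<close>

record 'a nspace =
  pts :: "'a set"
  nrm :: "'a \<Rightarrow> real"

definition open_in_nspace :: "'a::real_vector nspace \<Rightarrow> 'a set \<Rightarrow> bool" where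
  "open_in_nspace X U \<longleftrightarrow>
     U \<subseteq> pts X \<and> (\<forall>x\<in>U. \<exists>e>0. \<forall>y\<in>pts X. nrm X (y - x) < e \<longrightarrow> y \<in> U)"

definition linear_on_nspace ::
  "'a::real_vector nspace \<Rightarrow> 'b::real_vector nspace \<Rightarrow> ('a \<Rightarrow> 'b) \<Rightarrow> bool" where
  "linear_on_nspace X Y l \<longleftrightarrow>
     (\<forall>u\<in>pts X. l u \<in> pts Y) \<and>
     (\<forall>u\<in>pts X. \<forall>v\<in>pts X. l (u + v) = l u + l v) \<and>
     (\<forall>r. \<forall>u\<in>pts X. l (r *\<^sub>R u) = r *\<^sub>R l u)"

definition continuous_on_nspace ::
  "'a::real_vector nspace \<Rightarrow> 'b::real_vector nspace \<Rightarrow> ('a \<Rightarrow> 'b) \<Rightarrow> bool" where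
  "continuous_on_nspace X Y l \<longleftrightarrow>
     (\<forall>u\<in>pts X. \<forall>e>0. \<exists>\<delta>>0. \<forall>v\<in>pts X. nrm X (v - u) < \<delta> \<longrightarrow> nrm Y (l v - l u) < e)"

text \<open>
  An operator on \<open>X\<close> is represented by the function on the ambient space that is \<open>0\<close> outside
  \<open>pts X\<close>, so that operators that agree on \<open>pts X\<close> are equal.
\<close>

definition extend_by_zero :: "'a nspace \<Rightarrow> ('a \<Rightarrow> 'b::zero) \<Rightarrow> 'a \<Rightarrow> 'b" where
  "extend_by_zero X l = (\<lambda>u. if u \<in> pts X then l u else 0)"

definition operator_space :: "'a::real_vector nspace \<Rightarrow> ('a \<Rightarrow> 'a) nspace" where
  "operator_space X =
     \<lparr> pts = {l. linear_on_nspace X X l \<and> continuous_on_nspace X X l \<and> (\<forall>u. u \<notin> pts X \<longrightarrow> l u = 0)},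
       nrm = (\<lambda>l. SUP u\<in>{u\<in>pts X. nrm X u \<le> 1}. nrm X (l u)) \<rparr>"


section \<open>Analytic maps\<close>

text \<open>A \<open>k\<close>-linear map takes its arguments as a list of length \<open>k\<close>.\<close>

definition bounded_multilinear ::
  "'a::real_vector nspace \<Rightarrow> 'b::real_vector nspace \<Rightarrow> nat \<Rightarrow> ('a list \<Rightarrow> 'b) \<Rightarrow> bool" where
  "bounded_multilinear X Y k T \<longleftrightarrow>
     (\<forall>vs\<in>lists (pts X). length vs = k \<longrightarrow> T vs \<in> pts Y) \<and>
     (\<forall>us\<in>lists (pts X). \<forall>ws\<in>lists (pts X). length us + length ws + 1 = k \<longrightarrow>
        (\<forall>u\<in>pts X. \<forall>v\<in>pts X. T (us @ (u + v) # ws) = T (us @ u # ws) + T (us @ v # ws)) \<and>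
        (\<forall>r. \<forall>u\<in>pts X. T (us @ (r *\<^sub>R u) # ws) = r *\<^sub>R T (us @ u # ws))) \<and>
     (\<exists>C. \<forall>vs\<in>lists (pts X). length vs = k \<longrightarrow> nrm Y (T vs) \<le> C * prod_list (map (nrm X) vs))"

text \<open>
  \<open>D j x\<close> is the \<open>j\<close>-th derivative of \<open>F\<close> at \<open>x\<close>. Since \<open>U\<close> is open, the last condition
  determines \<open>D (Suc j) x\<close> from \<open>D j\<close> on \<open>(pts X)\<^bsup>j+1\<^esup>\<close>, so a family with these
  properties is unique there, and it exists iff \<open>F\<close> has derivatives of all orders in \<open>U\<close>.
\<close>

definition derivatives_on ::
  "'a::real_vector nspace \<Rightarrow> 'b::real_vector nspace \<Rightarrow> 'a set \<Rightarrow> ('a \<Rightarrow> 'b)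
     \<Rightarrow> (nat \<Rightarrow> 'a \<Rightarrow> 'a list \<Rightarrow> 'b) \<Rightarrow> bool" where
  "derivatives_on X Y U F D \<longleftrightarrow>
     (\<forall>x\<in>U. D 0 x [] = F x) \<and>
     (\<forall>j\<ge>1. \<forall>x\<in>U. bounded_multilinear X Y j (D j x)) \<and>
     (\<forall>j. \<forall>x\<in>U. \<forall>vs\<in>lists (pts X). length vs = j \<longrightarrow>
        (\<forall>e>0. \<exists>\<delta>>0. \<forall>v\<in>pts X. x + v \<in> U \<longrightarrow> 0 < nrm X v \<longrightarrow> nrm X v < \<delta> \<longrightarrow>
           nrm Y (D j (x + v) vs - D j x vs - D (Suc j) x (vs @ [v])) / nrm X v < e))"

definition analytic_map ::
  "'a::real_vector nspace \<Rightarrow> 'b::real_vector nspace \<Rightarrow> 'a set \<Rightarrow> ('a \<Rightarrow> 'b) \<Rightarrow> bool" where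
  "analytic_map X Y U F \<longleftrightarrow>
     open_in_nspace X U \<and> (\<forall>x\<in>U. F x \<in> pts Y) \<and>
     (\<exists>D. derivatives_on X Y U F D \<and>
        (\<forall>x\<in>U. \<exists>W. open_in_nspace X W \<and> x \<in> W \<and> W \<subseteq> U \<and>
           (\<forall>v\<in>pts X. x + v \<in> W \<longrightarrow>
              (\<lambda>n. nrm Y (F (x + v) - F x
                     - (\<Sum>j=1..n. (1 / fact j) *\<^sub>R D j x (replicate j v)))) \<longlonglongrightarrow> 0)))"


section \<open>Hoelder functions on sequences and the Ruelle operator\<close>

definition seq_dist :: "real \<Rightarrow> (nat \<Rightarrow> 'm::metric_space) \<Rightarrow> (nat \<Rightarrow> 'm) \<Rightarrow> real" where
  "seq_dist c x y = (\<Sum>k. dist (x k) (y k) / c ^ k)"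

lemma summable_seq_dist:
  fixes x y :: "nat \<Rightarrow> 'm::metric_space"
  assumes "compact (UNIV :: 'm set)" "c > 1"
  shows "summable (\<lambda>k. dist (x k) (y k) / c ^ k)"
proof -
  obtain B where B: "\<And>u v :: 'm. dist u v \<le> B"
    using compact_imp_bounded[OF assms(1)] by (metis UNIV_I bounded_two_points)
  have "summable (\<lambda>k. B * (1 / c) ^ k)"
    using assms(2) by (intro summable_mult summable_geometric) simp
  then show ?thesis
    using assms(2) B
    by (elim summable_comparison_test'[where N = 0])
       (simp add: power_one_over divide_right_mono field_simps)
qed

text \<open>
  This makes \<open>Metric_space.mtopology UNIV (seq_dist c)\<close>, used below, the topology of \<open>seq_dist c\<close>.
\<close>

lemma Metric_space_seq_dist:
  assumes "compact (UNIV :: 'm::metric_space set)" "c > 1"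
  shows "Metric_space UNIV (seq_dist c :: (nat \<Rightarrow> 'm) \<Rightarrow> _)"
proof
  note s = summable_seq_dist[OF assms]
  have c: "c ^ k > 0" for k using assms(2) by simp
  fix x y z :: "nat \<Rightarrow> 'm"
  show "0 \<le> seq_dist c x y"
    unfolding seq_dist_def using c by (intro suminf_nonneg[OF s]) (simp add: less_imp_le)
  show "seq_dist c x y = seq_dist c y x"
    by (simp add: seq_dist_def dist_commute)
  have "seq_dist c x y = 0 \<longleftrightarrow> (\<forall>k. dist (x k) (y k) / c ^ k = 0)"
    unfolding seq_dist_def using c by (intro suminf_eq_zero_iff[OF s]) (simp add: less_imp_le)
  then show "seq_dist c x y = 0 \<longleftrightarrow> x = y"
    using assms(2) by (auto simp: fun_eq_iff)
  have "dist (x k) (z k) / c ^ k \<le> dist (x k) (y k) / c ^ k + dist (y k) (z k) / c ^ k" for k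
    using divide_right_mono[OF dist_triangle less_imp_le[OF c]] by (metis add_divide_distrib)
  then show "seq_dist c x z \<le> seq_dist c x y + seq_dist c y z"
    unfolding seq_dist_def suminf_add[OF s s] by (intro suminf_le s summable_add)
qed

definition sup_norm :: "('a \<Rightarrow> real) \<Rightarrow> real" where
  "sup_norm \<phi> = (SUP x. \<bar>\<phi> x\<bar>)"

definition Holder_quotients ::
  "real \<Rightarrow> real \<Rightarrow> ((nat \<Rightarrow> 'm::metric_space) \<Rightarrow> real) \<Rightarrow> real set" where
  "Holder_quotients c \<gamma> \<phi> = {\<bar>\<phi> y - \<phi> x\<bar> / seq_dist c x y powr \<gamma> | x y. x \<noteq> y}"

text \<open>
  The inserted \<open>0\<close> only matters if \<open>'m\<close> has a single element: there are no quotients then, and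
  the supremum of the empty set of nonnegative numbers is meant to be \<open>0\<close>.
\<close>

definition Holder_const ::
  "real \<Rightarrow> real \<Rightarrow> ((nat \<Rightarrow> 'm::metric_space) \<Rightarrow> real) \<Rightarrow> real" where
  "Holder_const c \<gamma> \<phi> = Sup (insert 0 (Holder_quotients c \<gamma> \<phi>))"

definition Holder_space :: "real \<Rightarrow> real \<Rightarrow> ((nat \<Rightarrow> 'm::metric_space) \<Rightarrow> real) nspace" where
  "Holder_space c \<gamma> =
     (if \<gamma> = 0 then
        \<lparr> pts = {\<phi>. continuous_map (Metric_space.mtopology UNIV (seq_dist c)) euclideanreal \<phi>},
          nrm = sup_norm \<rparr>
      else
        \<lparr> pts = {\<phi>. bdd_above (Holder_quotients c \<gamma> \<phi>)},
          nrm = (\<lambda>\<phi>. sup_norm \<phi> + Holder_const c \<gamma> \<phi>) \<rparr>)"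

text \<open>\<open>case_nat a x\<close> is the sequence \<open>(a, x\<^sub>0, x\<^sub>1, \<dots>)\<close>.\<close>

definition ruelle ::
  "'m measure \<Rightarrow> ((nat \<Rightarrow> 'm) \<Rightarrow> real) \<Rightarrow> ((nat \<Rightarrow> 'm) \<Rightarrow> real) \<Rightarrow> (nat \<Rightarrow> 'm) \<Rightarrow> real" where
  "ruelle \<mu> \<psi> \<phi> x = (\<integral>a. exp (\<psi> (case_nat a x)) * \<phi> (case_nat a x) \<partial>\<mu>)"

definition Ruelle_map ::
  "real \<Rightarrow> real \<Rightarrow> 'm::metric_space measure \<Rightarrow> ((nat \<Rightarrow> 'm) \<Rightarrow> real)
     \<Rightarrow> ((nat \<Rightarrow> 'm) \<Rightarrow> real) \<Rightarrow> ((nat \<Rightarrow> 'm) \<Rightarrow> real)" where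
  "Ruelle_map c \<gamma> \<mu> \<psi> = extend_by_zero (Holder_space c \<gamma>) (ruelle \<mu> \<psi>)"

end

theory Submission
  imports Defs
begin

text \<open>
  Both for \<open>\<gamma> = 0\<close> and for \<open>\<gamma> > 0\<close> the space \<open>C\<^sup>\<gamma>\<close> is a Banach algebra under pointwise
  multiplication, with \<open>|fg|\<^sub>\<gamma> \<le> |f|\<^sub>\<gamma> |g|\<^sub>\<gamma>\<close>. Write \<open>L f (x) = \<integral> f(ax) d\<mu>(a)\<close> for the transfer operator
  of the zero potential. It is a bounded linear operator on \<open>C\<^sup>\<gamma>\<close>, with bound \<open>\<mu>(M)\<close>, because
  prepending the same symbol to two sequences brings them closer together. The Ruelle operator is
  \<open>L\<close> preceded by multiplication with a weight:
  \<open>\<L>\<^sub>\<psi> \<phi> = L (e\<^sup>\<psi> \<phi>)\<close>. So \<open>\<Theta>\<close> is the composition of the exponential function of a Banach algebra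
  with the bounded linear map that sends a weight \<open>f\<close> to the operator \<open>\<phi> \<mapsto> L (f \<phi>)\<close>, and it is
  analytic because the exponential function is. Explicitly,
  \<open>D\<^sup>j\<Theta>(\<psi>)(v\<^sub>1, \<dots>, v\<^sub>j) \<phi> = L (e\<^sup>\<psi> v\<^sub>1 \<cdots> v\<^sub>j \<phi>)\<close>.

  All estimates reduce to one: the remainder \<open>e\<^sup>v - \<Sum>\<^bsub>k<n\<^esub> v\<^sup>k / k!\<close> has norm at most
  \<open>e\<^bsup>|v|\<^esup> - \<Sum>\<^bsub>k<n\<^esub> |v|\<^sup>k / k!\<close> (lemma \<open>nrm_exp_remainder\<close>). As
  \<open>e\<^bsup>\<psi>+v\<^esup> = e\<^sup>\<psi> e\<^sup>v\<close>, the case \<open>n = 2\<close> bounds the error of each derivative by a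
  multiple of \<open>|v|\<^sup>2\<close> (lemma \<open>D_remainder\<close>), and \<open>n \<rightarrow> \<infinity>\<close> gives convergence of the Taylor series for
  every \<open>v\<close> (lemma \<open>taylor_D\<close>).

  This argument is carried out for an abstract algebra of functions and an arbitrary bounded
  operator \<open>L\<close>. Afterwards the Hoelder spaces and the transfer operator are shown to be an instance.
\<close>


section \<open>Normed algebras of functions\<close>

lemma scaleR_fun_apply [simp]: "(r *\<^sub>R f) x = r *\<^sub>R f x"
  by (simp add: scaleR_fun_def)

lemma sum_fun_apply [simp]: "(\<Sum>i\<in>A. f i) x = (\<Sum>i\<in>A. f i x)"
  by (induction A rule: infinite_finite_induct) auto

lemma power_fun_apply: "(f ^ k) p = f p ^ k" for f :: "'p \<Rightarrow> real"
  by (induction k) auto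

definition expf :: "('p \<Rightarrow> real) \<Rightarrow> 'p \<Rightarrow> real" where
  "expf f = (\<lambda>p. exp (f p))"

lemma expf_add: "expf (f + g) = expf f * expf g"
  by (simp add: expf_def fun_eq_iff exp_add)

lemma abs_sums_le:
  fixes f :: "nat \<Rightarrow> real"
  assumes "f sums s" "\<And>n. \<bar>f n\<bar> \<le> M n" "summable M"
  shows "\<bar>s\<bar> \<le> suminf M"
  using norm_suminf_le[of f M] assms by (simp add: sums_iff)

text \<open>
  The properties of a unital Banach algebra of real functions, with pointwise operations, on which
  the calculus of the exponential function rests. Completeness is stated, in the last two
  assumptions, for absolutely convergent series whose pointwise sum is given: that is how it is used
  for the exponential series, and it is direct to verify when the norm is built from suprema. An inequality is enough for homogeneity, since scaling by \<open>1 / r\<close> gives the converse.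
\<close>

locale function_algebra =
  fixes X :: "('p \<Rightarrow> real) nspace"
  assumes one_mem: "1 \<in> pts X"
    and nrm_one: "nrm X 1 \<le> 1"
    and add_mem: "\<lbrakk>f \<in> pts X; g \<in> pts X\<rbrakk> \<Longrightarrow> f + g \<in> pts X"
    and nrm_add: "\<lbrakk>f \<in> pts X; g \<in> pts X\<rbrakk> \<Longrightarrow> nrm X (f + g) \<le> nrm X f + nrm X g"
    and scaleR_mem: "f \<in> pts X \<Longrightarrow> r *\<^sub>R f \<in> pts X"
    and nrm_scaleR: "f \<in> pts X \<Longrightarrow> nrm X (r *\<^sub>R f) \<le> \<bar>r\<bar> * nrm X f"
    and mult_mem: "\<lbrakk>f \<in> pts X; g \<in> pts X\<rbrakk> \<Longrightarrow> f * g \<in> pts X"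
    and nrm_mult: "\<lbrakk>f \<in> pts X; g \<in> pts X\<rbrakk> \<Longrightarrow> nrm X (f * g) \<le> nrm X f * nrm X g"
    and sums_mem: "\<lbrakk>\<And>n. F n \<in> pts X; summable (\<lambda>n. nrm X (F n)); \<And>p. (\<lambda>n. F n p) sums g p\<rbrakk>
      \<Longrightarrow> g \<in> pts X"
    and nrm_sums: "\<lbrakk>\<And>n. F n \<in> pts X; summable (\<lambda>n. nrm X (F n)); \<And>p. (\<lambda>n. F n p) sums g p\<rbrakk>
      \<Longrightarrow> nrm X g \<le> (\<Sum>n. nrm X (F n))"
begin

lemma zero_mem: "0 \<in> pts X"
  using scaleR_mem[OF one_mem, of 0] by simp

lemma nrm_zero: "nrm X 0 = 0"
  using nrm_scaleR[OF one_mem, of 0] nrm_add[OF zero_mem zero_mem] by simp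

lemma nrm_nonneg:
  assumes "f \<in> pts X"
  shows "0 \<le> nrm X f"
  using nrm_add[OF assms scaleR_mem[OF assms, of "- 1"]] nrm_scaleR[OF assms, of "- 1"]
  by (simp add: nrm_zero)

lemma diff_mem:
  assumes "f \<in> pts X" "g \<in> pts X"
  shows "f - g \<in> pts X"
  using add_mem[OF assms(1) scaleR_mem[OF assms(2), of "- 1"]] by simp

lemma power_mem: "f \<in> pts X \<Longrightarrow> f ^ k \<in> pts X"
  by (induction k) (simp_all add: one_mem mult_mem)

lemma nrm_power: "f \<in> pts X \<Longrightarrow> nrm X (f ^ k) \<le> nrm X f ^ k"
proof (induction k)
  case (Suc k)
  note f = Suc.prems
  have "nrm X (f ^ Suc k) \<le> nrm X f * nrm X (f ^ k)"
    using nrm_mult[OF f power_mem[OF f]] by simp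
  also have "\<dots> \<le> nrm X f * nrm X f ^ k"
    by (intro mult_left_mono Suc.IH nrm_nonneg f)
  also have "\<dots> = nrm X f ^ Suc k" by simp
  finally show ?case .
qed (simp add: nrm_one)

lemma prod_list_mem: "set fs \<subseteq> pts X \<Longrightarrow> prod_list fs \<in> pts X"
  by (induction fs) (simp_all add: one_mem mult_mem)

lemma nrm_prod_list: "set fs \<subseteq> pts X \<Longrightarrow> nrm X (prod_list fs) \<le> prod_list (map (nrm X) fs)"
proof (induction fs)
  case (Cons f fs)
  then have f: "f \<in> pts X" and fs: "set fs \<subseteq> pts X" by auto
  have "nrm X (prod_list (f # fs)) \<le> nrm X f * nrm X (prod_list fs)"
    using nrm_mult[OF f prod_list_mem[OF fs]] by simp
  also have "\<dots> \<le> nrm X f * prod_list (map (nrm X) fs)"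
    by (intro mult_left_mono Cons.IH fs nrm_nonneg f)
  also have "\<dots> = prod_list (map (nrm X) (f # fs))" by simp
  finally show ?case .
qed (simp add: nrm_one)

text \<open>
  Remainders of the exponential series are themselves absolutely convergent series, with terms
  dominated by those of the real exponential series at \<open>nrm X f\<close>. The case \<open>n = 0\<close> says that the
  algebra is closed under the exponential function.
\<close>

definition exp_remainder :: "nat \<Rightarrow> ('p \<Rightarrow> real) \<Rightarrow> 'p \<Rightarrow> real" where
  "exp_remainder n f = expf f - (\<Sum>k<n. (1 / fact k) *\<^sub>R f ^ k)"

lemma exp_remainder:
  assumes f: "f \<in> pts X"
  shows exp_remainder_mem: "exp_remainder n f \<in> pts X"
    and nrm_exp_remainder:
      "nrm X (exp_remainder n f) \<le> exp (nrm X f) - (\<Sum>k<n. nrm X f ^ k / fact k)"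
proof -
  define t where "t k = (1 / fact (k + n)) *\<^sub>R f ^ (k + n)" for k
  \<comment> \<open>Used both for the values \<open>r = f p\<close> and for the norm \<open>r = nrm X f\<close>.\<close>
  have tail: "(\<lambda>k. r ^ (k + n) / fact (k + n)) sums (exp r - (\<Sum>k<n. r ^ k / fact k))" for r :: real
    using exp_converges[of r] sums_iff_shift[of "\<lambda>k. r ^ k / fact k" n]
    by (simp add: divide_inverse mult.commute)
  have t_mem: "t k \<in> pts X" for k
    unfolding t_def by (intro scaleR_mem power_mem f)
  have t_le: "nrm X (t k) \<le> nrm X f ^ (k + n) / fact (k + n)" for k
  proof -
    have "nrm X (t k) \<le> \<bar>1 / fact (k + n)\<bar> * nrm X (f ^ (k + n))"
      unfolding t_def by (intro nrm_scaleR power_mem f)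
    also have "\<dots> \<le> \<bar>1 / fact (k + n)\<bar> * nrm X f ^ (k + n)"
      by (intro mult_left_mono nrm_power f) simp
    finally show ?thesis by simp
  qed
  have summ: "summable (\<lambda>k. nrm X (t k))"
    by (rule summable_comparison_test'[OF sums_summable[OF tail, of "nrm X f"], of 0])
       (use t_le nrm_nonneg[OF t_mem] in simp)
  have sums: "(\<lambda>k. t k p) sums exp_remainder n f p" for p
    using tail[of "f p"] by (simp add: t_def exp_remainder_def expf_def power_fun_apply)
  show "exp_remainder n f \<in> pts X"
    by (rule sums_mem[OF t_mem summ sums])
  have "nrm X (exp_remainder n f) \<le> (\<Sum>k. nrm X (t k))"
    by (rule nrm_sums[OF t_mem summ sums])
  also have "\<dots> \<le> (\<Sum>k. nrm X f ^ (k + n) / fact (k + n))"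
    by (intro suminf_le t_le summ sums_summable[OF tail])
  also have "\<dots> = exp (nrm X f) - (\<Sum>k<n. nrm X f ^ k / fact k)"
    using sums_unique[OF tail] by simp
  finally show "nrm X (exp_remainder n f) \<le> exp (nrm X f) - (\<Sum>k<n. nrm X f ^ k / fact k)" .
qed

lemma expf_mem: "f \<in> pts X \<Longrightarrow> expf f \<in> pts X"
  using exp_remainder_mem[of f 0] by (simp add: exp_remainder_def)

lemma nrm_exp_remainder_two:
  assumes "f \<in> pts X" "nrm X f \<le> 1"
  shows "nrm X (exp_remainder 2 f) \<le> (nrm X f)\<^sup>2"
  using nrm_exp_remainder[OF assms(1), of 2] exp_bound[OF nrm_nonneg[OF assms(1)] assms(2)]
  by (simp add: numeral_2_eq_2)

lemma exp_remainder_tendsto_0: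
  assumes "f \<in> pts X"
  shows "(\<lambda>n. nrm X (exp_remainder n f)) \<longlonglongrightarrow> 0"
proof (rule tendsto_sandwich[OF always_eventually always_eventually tendsto_const])
  have "(\<lambda>n. \<Sum>k<n. nrm X f ^ k / fact k) \<longlonglongrightarrow> exp (nrm X f)"
    using exp_converges[of "nrm X f"] by (simp add: sums_def divide_inverse mult.commute)
  then show "(\<lambda>n. exp (nrm X f) - (\<Sum>k<n. nrm X f ^ k / fact k)) \<longlonglongrightarrow> 0"
    by (auto intro!: tendsto_eq_intros)
qed (simp_all add: nrm_exp_remainder nrm_nonneg exp_remainder_mem assms)

end


section \<open>Weighted operators\<close>

text \<open>
  In the application, \<open>L\<close> is the Ruelle operator of the potential \<open>0\<close> and \<open>C\<close> is the total mass
  of the measure.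
\<close>

locale weighted_operator = function_algebra X for X :: "('p \<Rightarrow> real) nspace" +
  fixes L :: "('p \<Rightarrow> real) \<Rightarrow> 'p \<Rightarrow> real" and C :: real
  assumes L_mem: "f \<in> pts X \<Longrightarrow> L f \<in> pts X"
    and L_add: "\<lbrakk>f \<in> pts X; g \<in> pts X\<rbrakk> \<Longrightarrow> L (f + g) = L f + L g"
    and L_scaleR: "f \<in> pts X \<Longrightarrow> L (r *\<^sub>R f) = r *\<^sub>R L f"
    and C_nonneg: "0 \<le> C"
    and nrm_L: "f \<in> pts X \<Longrightarrow> nrm X (L f) \<le> C * nrm X f"
begin

definition weighted :: "('p \<Rightarrow> real) \<Rightarrow> ('p \<Rightarrow> real) \<Rightarrow> 'p \<Rightarrow> real" where
  "weighted f = extend_by_zero X (\<lambda>u. L (f * u))"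

lemma weighted_add:
  assumes "f \<in> pts X" "g \<in> pts X"
  shows "weighted (f + g) = weighted f + weighted g"
  using assms
  by (auto simp: weighted_def extend_by_zero_def fun_eq_iff[of _ "_ + _"] distrib_right L_add mult_mem)

lemma weighted_scaleR:
  assumes "f \<in> pts X"
  shows "weighted (r *\<^sub>R f) = r *\<^sub>R weighted f"
proof
  fix u
  have "(r *\<^sub>R f) * u = r *\<^sub>R (f * u)" by (simp add: fun_eq_iff)
  then show "weighted (r *\<^sub>R f) u = (r *\<^sub>R weighted f) u"
    using assms by (simp add: weighted_def extend_by_zero_def L_scaleR mult_mem)
qed

lemma weighted_diff:
  assumes "f \<in> pts X" "g \<in> pts X"
  shows "weighted (f - g) = weighted f - weighted g"
  using weighted_add[OF assms(1) scaleR_mem[OF assms(2), of "- 1"]]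
    weighted_scaleR[OF assms(2), of "- 1"]
  by simp

lemma weighted_zero: "weighted 0 = 0"
  using weighted_scaleR[OF zero_mem, of 0] by simp

lemma weighted_sum: "(\<And>i. i \<in> A \<Longrightarrow> f i \<in> pts X) \<Longrightarrow>
  (\<Sum>i\<in>A. f i) \<in> pts X \<and> weighted (\<Sum>i\<in>A. f i) = (\<Sum>i\<in>A. weighted (f i))"
  by (induction A rule: infinite_finite_induct) (auto simp: zero_mem weighted_zero weighted_add add_mem)

lemma nrm_weighted_apply:
  assumes "f \<in> pts X" "u \<in> pts X"
  shows "nrm X (weighted f u) \<le> C * nrm X f * nrm X u"
proof -
  have "nrm X (L (f * u)) \<le> C * nrm X (f * u)"
    using assms by (intro nrm_L mult_mem)
  also have "\<dots> \<le> C * (nrm X f * nrm X u)"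
    by (intro mult_left_mono nrm_mult assms C_nonneg)
  finally show ?thesis
    using assms(2) by (simp add: weighted_def extend_by_zero_def)
qed

lemma weighted_mem:
  assumes f: "f \<in> pts X"
  shows "weighted f \<in> pts (operator_space X)"
proof -
  have weighted_eq: "weighted f u = L (f * u)" if "u \<in> pts X" for u
    using that by (simp add: weighted_def extend_by_zero_def)
  have mult_scaleR: "f * r *\<^sub>R u = r *\<^sub>R (f * u)" for r u
    by (simp add: fun_eq_iff)
  have lin: "linear_on_nspace X X (weighted f)"
    using f by (auto simp: linear_on_nspace_def weighted_eq add_mem scaleR_mem mult_mem L_mem
        distrib_left L_add L_scaleR mult_scaleR)
  have weighted_diff': "weighted f v - weighted f u = weighted f (v - u)"
    if "u \<in> pts X" "v \<in> pts X" for u v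
  proof -
    have "weighted f v = weighted f (v - u) + weighted f u"
      using lin that diff_mem[OF that(2,1)] unfolding linear_on_nspace_def
      by (metis diff_add_cancel)
    then show ?thesis by simp
  qed
  have "continuous_on_nspace X X (weighted f)"
    unfolding continuous_on_nspace_def
  proof (intro ballI allI impI)
    fix u e assume u: "u \<in> pts X" and e: "(0::real) < e"
    \<comment> \<open>The summand \<open>1\<close> makes \<open>K\<close> positive, so that \<open>e / K\<close> is meaningful.\<close>
    define K where "K = C * nrm X f + 1"
    have K: "K > 0"
      using C_nonneg nrm_nonneg[OF f] unfolding K_def by (simp add: add_nonneg_pos)
    show "\<exists>\<delta>>0. \<forall>v\<in>pts X. nrm X (v - u) < \<delta> \<longrightarrow> nrm X (weighted f v - weighted f u) < e"
    proof (intro exI[of _ "e / K"] conjI ballI impI)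
      fix v assume v: "v \<in> pts X" and lt: "nrm X (v - u) < e / K"
      have "nrm X (weighted f v - weighted f u) \<le> C * nrm X f * nrm X (v - u)"
        unfolding weighted_diff'[OF u v] by (intro nrm_weighted_apply f diff_mem u v)
      also have "\<dots> \<le> K * nrm X (v - u)"
        by (intro mult_right_mono nrm_nonneg diff_mem u v) (simp add: K_def)
      also have "\<dots> < e"
        using lt K by (simp add: field_simps)
      finally show "nrm X (weighted f v - weighted f u) < e" .
    qed (use e K in simp)
  qed
  with lin show ?thesis
    by (simp add: operator_space_def weighted_def extend_by_zero_def)
qed

lemma nrm_weighted_le:
  assumes f: "f \<in> pts X"
  shows "nrm (operator_space X) (weighted f) \<le> C * nrm X f"
proof -
  have "(SUP u\<in>{u \<in> pts X. nrm X u \<le> 1}. nrm X (weighted f u)) \<le> C * nrm X f"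
  proof (rule cSUP_least)
    show "{u \<in> pts X. nrm X u \<le> 1} \<noteq> {}"
      using zero_mem nrm_zero by force
    fix u assume "u \<in> {u \<in> pts X. nrm X u \<le> 1}"
    then have u: "u \<in> pts X" "nrm X u \<le> 1" by auto
    have "nrm X (weighted f u) \<le> C * nrm X f * nrm X u"
      by (rule nrm_weighted_apply[OF f u(1)])
    also have "\<dots> \<le> C * nrm X f"
      using u(2) C_nonneg nrm_nonneg[OF f] by (intro mult_left_le mult_nonneg_nonneg)
    finally show "nrm X (weighted f u) \<le> C * nrm X f" .
  qed
  then show ?thesis by (simp add: operator_space_def)
qed

text \<open>
  The operator norm is a supremum, so its sign is known only because the set in question is bounded
  above and contains the value at \<open>0\<close>.
\<close>

lemma nrm_weighted_nonneg:
  assumes f: "f \<in> pts X"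
  shows "0 \<le> nrm (operator_space X) (weighted f)"
proof -
  have zero_in: "0 \<in> {u \<in> pts X. nrm X u \<le> 1}"
    by (simp add: zero_mem nrm_zero)
  have "nrm X (weighted f 0) \<le> (SUP u\<in>{u \<in> pts X. nrm X u \<le> 1}. nrm X (weighted f u))"
  proof (rule cSUP_upper[OF zero_in])
    show "bdd_above ((\<lambda>u. nrm X (weighted f u)) ` {u \<in> pts X. nrm X u \<le> 1})"
    proof (rule bdd_aboveI2)
      fix u assume u: "u \<in> {u \<in> pts X. nrm X u \<le> 1}"
      then have "nrm X (weighted f u) \<le> C * nrm X f * nrm X u"
        by (intro nrm_weighted_apply f) auto
      also have "\<dots> \<le> C * nrm X f"
        using u C_nonneg nrm_nonneg[OF f] by (intro mult_left_le mult_nonneg_nonneg) auto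
      finally show "nrm X (weighted f u) \<le> C * nrm X f" .
    qed
  qed
  moreover have "weighted f 0 = 0"
    using L_scaleR[OF zero_mem, of 0] by (simp add: weighted_def extend_by_zero_def)
  ultimately show ?thesis by (simp add: operator_space_def nrm_zero)
qed

text \<open>
  The exponential function is its own derivative in the sense that differentiating \<open>expf f\<close> in
  the direction \<open>v\<close> multiplies it by \<open>v\<close>. Hence each further derivative appends one factor to the
  weight.
\<close>

definition D :: "nat \<Rightarrow> ('p \<Rightarrow> real) \<Rightarrow> ('p \<Rightarrow> real) list \<Rightarrow> ('p \<Rightarrow> real) \<Rightarrow> 'p \<Rightarrow> real" where
  "D j f vs = weighted (expf f * prod_list vs)"

text \<open>
  The bound is \<open>C * nrm X (expf f)\<close>: each argument enters as a factor of the weight.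
\<close>

lemma bounded_multilinear_D:
  assumes f: "f \<in> pts X"
  shows "bounded_multilinear X (operator_space X) j (D j f)"
  unfolding bounded_multilinear_def
proof (intro conjI ballI allI impI exI)
  note e = expf_mem[OF f]
  \<comment> \<open>Additivity and homogeneity in one argument, the others being \<open>us\<close> and \<open>ws\<close>.\<close>
  fix us ws u v assume us: "us \<in> lists (pts X)" and ws: "ws \<in> lists (pts X)" and u: "u \<in> pts X"
  have pu: "prod_list us \<in> pts X" and pw: "prod_list ws \<in> pts X"
    using us ws by (auto intro!: prod_list_mem)
  { assume v: "v \<in> pts X"
    have "expf f * prod_list (us @ (u + v) # ws)
        = expf f * prod_list (us @ u # ws) + expf f * prod_list (us @ v # ws)"
      by (simp add: algebra_simps)
    then show "D j f (us @ (u + v) # ws) = D j f (us @ u # ws) + D j f (us @ v # ws)"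
      using u v pu pw by (simp add: D_def weighted_add mult_mem e) }
  fix r
  have "expf f * prod_list (us @ (r *\<^sub>R u) # ws) = r *\<^sub>R (expf f * prod_list (us @ u # ws))"
    by (simp add: fun_eq_iff)
  then show "D j f (us @ (r *\<^sub>R u) # ws) = r *\<^sub>R D j f (us @ u # ws)"
    using u pu pw by (simp add: D_def weighted_scaleR mult_mem e)
next
  note e = expf_mem[OF f]
  fix vs assume "vs \<in> lists (pts X)"
  then have vs: "set vs \<subseteq> pts X" by auto
  have pv: "prod_list vs \<in> pts X" by (rule prod_list_mem[OF vs])
  show "D j f vs \<in> pts (operator_space X)"
    unfolding D_def by (intro weighted_mem mult_mem e pv)
  have "nrm (operator_space X) (D j f vs) \<le> C * nrm X (expf f * prod_list vs)"
    unfolding D_def by (intro nrm_weighted_le mult_mem e pv)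
  also have "\<dots> \<le> C * (nrm X (expf f) * nrm X (prod_list vs))"
    by (intro mult_left_mono nrm_mult e pv C_nonneg)
  also have "\<dots> \<le> C * (nrm X (expf f) * prod_list (map (nrm X) vs))"
    by (intro mult_left_mono nrm_prod_list vs C_nonneg nrm_nonneg e)
  finally show "nrm (operator_space X) (D j f vs)
      \<le> C * nrm X (expf f) * prod_list (map (nrm X) vs)"
    by (simp add: mult.assoc)
qed

text \<open>
  By linearity in the weight, the difference is the weighted operator for
  \<open>g e\<^sup>v - g - g v = g (e\<^sup>v - 1 - v)\<close>, where \<open>g\<close> is the weight of \<open>D j f vs\<close>.
\<close>

lemma D_remainder:
  assumes f: "f \<in> pts X" and vs: "set vs \<subseteq> pts X" and v: "v \<in> pts X" and "nrm X v \<le> 1"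
  shows "nrm (operator_space X) (D j (f + v) vs - D j f vs - D (Suc j) f (vs @ [v]))
      \<le> C * nrm X (expf f * prod_list vs) * (nrm X v)\<^sup>2"
proof -
  define g where "g = expf f * prod_list vs"
  have g: "g \<in> pts X"
    unfolding g_def by (intro mult_mem expf_mem f prod_list_mem vs)
  have "D j (f + v) vs - D j f vs - D (Suc j) f (vs @ [v])
      = weighted (g * expf v) - weighted g - weighted (g * v)"
    by (simp add: D_def g_def expf_add ac_simps)
  also have "\<dots> = weighted (g * expf v - g - g * v)"
    by (simp add: weighted_diff diff_mem mult_mem expf_mem g v)
  also have "g * expf v - g - g * v = g * exp_remainder 2 v"
    by (simp add: exp_remainder_def numeral_2_eq_2 fun_eq_iff algebra_simps)
  finally have eq: "D j (f + v) vs - D j f vs - D (Suc j) f (vs @ [v])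
      = weighted (g * exp_remainder 2 v)" .
  have "nrm (operator_space X) (D j (f + v) vs - D j f vs - D (Suc j) f (vs @ [v]))
      \<le> C * nrm X (g * exp_remainder 2 v)"
    unfolding eq by (intro nrm_weighted_le mult_mem g exp_remainder_mem v)
  also have "\<dots> \<le> C * (nrm X g * nrm X (exp_remainder 2 v))"
    by (intro mult_left_mono nrm_mult g exp_remainder_mem v C_nonneg)
  also have "\<dots> \<le> C * (nrm X g * (nrm X v)\<^sup>2)"
    by (intro mult_left_mono nrm_exp_remainder_two v assms C_nonneg nrm_nonneg g)
  finally show ?thesis by (simp add: g_def)
qed

lemma derivatives_on_D:
  "derivatives_on X (operator_space X) (pts X) (\<lambda>f. weighted (expf f)) D"
  unfolding derivatives_on_def
proof (intro conjI ballI allI impI)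
  fix j f vs and e :: real
  assume f: "f \<in> pts X" and "vs \<in> lists (pts X)" and e: "0 < e"
  then have vs: "set vs \<subseteq> pts X" by auto
  define K where "K = C * nrm X (expf f * prod_list vs) + 1"
  have "K > 0"
    using C_nonneg nrm_nonneg[OF mult_mem[OF expf_mem[OF f] prod_list_mem[OF vs]]]
    unfolding K_def by (simp add: add_nonneg_pos)
  show "\<exists>\<delta>>0. \<forall>v\<in>pts X. f + v \<in> pts X \<longrightarrow> 0 < nrm X v \<longrightarrow> nrm X v < \<delta> \<longrightarrow>
      nrm (operator_space X) (D j (f + v) vs - D j f vs - D (Suc j) f (vs @ [v])) / nrm X v < e"
  proof (intro exI[of _ "min 1 (e / K)"] conjI ballI impI)
    fix v assume v: "v \<in> pts X" "0 < nrm X v" "nrm X v < min 1 (e / K)"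
    have "nrm (operator_space X) (D j (f + v) vs - D j f vs - D (Suc j) f (vs @ [v]))
        \<le> C * nrm X (expf f * prod_list vs) * (nrm X v)\<^sup>2"
      using v by (intro D_remainder f vs) auto
    also have "\<dots> \<le> K * (nrm X v)\<^sup>2"
      by (intro mult_right_mono) (simp_all add: K_def)
    finally have "nrm (operator_space X) (D j (f + v) vs - D j f vs - D (Suc j) f (vs @ [v]))
        / nrm X v \<le> K * nrm X v"
      using v by (simp add: field_simps power2_eq_square)
    also have "\<dots> < e"
      using v \<open>K > 0\<close> by (simp add: field_simps)
    finally show "nrm (operator_space X) (D j (f + v) vs - D j f vs - D (Suc j) f (vs @ [v]))
        / nrm X v < e" .
  qed (use e \<open>K > 0\<close> in simp)
qed (auto simp: D_def bounded_multilinear_D)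

text \<open>
  The Taylor polynomial of degree \<open>n\<close> belongs to the weight \<open>expf f\<close> times a partial sum of the
  exponential series at \<open>v\<close>, so the error is governed by the remainder of that series, for \<open>v\<close> of
  any size.
\<close>

lemma taylor_D:
  assumes f: "f \<in> pts X" and v: "v \<in> pts X"
  shows "(\<lambda>n. nrm (operator_space X) (weighted (expf (f + v)) - weighted (expf f)
      - (\<Sum>j=1..n. (1 / fact j) *\<^sub>R D j f (replicate j v)))) \<longlonglongrightarrow> 0"
proof -
  note ef = expf_mem[OF f]
  define g where "g j = expf f * ((1 / fact j) *\<^sub>R v ^ j)" for j
  have g: "g j \<in> pts X" for j
    unfolding g_def by (intro mult_mem ef scaleR_mem power_mem v)
  have gW: "(1 / fact j) *\<^sub>R D j f (replicate j v) = weighted (g j)" for j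
  proof -
    have "g j = (1 / fact j) *\<^sub>R (expf f * v ^ j)"
      by (simp add: g_def fun_eq_iff)
    then show ?thesis
      by (simp add: D_def weighted_scaleR mult_mem ef power_mem v)
  qed
  have eq: "weighted (expf (f + v)) - weighted (expf f)
        - (\<Sum>j=1..n. (1 / fact j) *\<^sub>R D j f (replicate j v))
      = weighted (expf f * exp_remainder (Suc n) v)" for n
  proof -
    have 1: "(\<Sum>j=1..n. (1 / fact j) *\<^sub>R D j f (replicate j v)) = weighted (\<Sum>j=1..n. g j)"
      and 2: "(\<Sum>j=1..n. g j) \<in> pts X"
      unfolding gW using weighted_sum[of "{1..n}" g] g by auto
    have "expf f * exp_remainder (Suc n) v = expf (f + v) - (\<Sum>j<Suc n. g j)"
      by (simp only: exp_remainder_def expf_add g_def right_diff_distrib sum_distrib_left)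
    also have "{..<Suc n} = insert 0 {1..n}" by auto
    also have "expf (f + v) - (\<Sum>j\<in>insert 0 {1..n}. g j)
        = expf (f + v) - expf f - (\<Sum>j=1..n. g j)"
      by (simp add: g_def fun_eq_iff)
    finally have 3: "expf f * exp_remainder (Suc n) v = expf (f + v) - expf f - (\<Sum>j=1..n. g j)" .
    show ?thesis
      unfolding 1 3 using 2 by (simp add: weighted_diff diff_mem expf_mem add_mem f v)
  qed
  have le: "nrm (operator_space X) (weighted (expf f * exp_remainder (Suc n) v))
      \<le> C * nrm X (expf f) * nrm X (exp_remainder (Suc n) v)" for n
  proof -
    have "nrm (operator_space X) (weighted (expf f * exp_remainder (Suc n) v))
        \<le> C * nrm X (expf f * exp_remainder (Suc n) v)"
      by (intro nrm_weighted_le mult_mem ef exp_remainder_mem v)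
    also have "\<dots> \<le> C * (nrm X (expf f) * nrm X (exp_remainder (Suc n) v))"
      by (intro mult_left_mono nrm_mult ef exp_remainder_mem v C_nonneg)
    finally show ?thesis by (simp add: mult.assoc)
  qed
  show ?thesis
    unfolding eq
  proof (rule tendsto_sandwich[OF always_eventually always_eventually tendsto_const])
    show "(\<lambda>n. C * nrm X (expf f) * nrm X (exp_remainder (Suc n) v)) \<longlonglongrightarrow> 0"
      by (rule tendsto_mult_right_zero[OF LIMSEQ_Suc[OF exp_remainder_tendsto_0[OF v]]])
  qed (auto simp: le nrm_weighted_nonneg mult_mem ef exp_remainder_mem v)
qed

theorem analytic_weighted_exp:
  "analytic_map X (operator_space X) (pts X) (\<lambda>f. weighted (expf f))"
proof -
  have op: "open_in_nspace X (pts X)"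
    by (auto simp: open_in_nspace_def intro: exI[of _ 1])
  show ?thesis
    unfolding analytic_map_def
    using op derivatives_on_D taylor_D
    by (auto simp: weighted_mem expf_mem intro!: exI[of _ D] exI[of _ "pts X"])
qed

end


section \<open>The sequence space\<close>

locale ruelle_system = finite_measure \<mu> for \<mu> :: "'m::metric_space measure" +
  fixes c :: real
  assumes compact_symbols: "compact (UNIV :: 'm set)"
    and sets_eq_borel: "sets \<mu> = sets borel"
    and c_gt_1: "c > 1"
begin

abbreviation d :: "(nat \<Rightarrow> 'm) \<Rightarrow> (nat \<Rightarrow> 'm) \<Rightarrow> real" where
  "d \<equiv> seq_dist c"

sublocale d: Metric_space UNIV d
  by (rule Metric_space_seq_dist[OF compact_symbols c_gt_1])

lemma summable_d: "summable (\<lambda>k. dist (x k) (y k) / c ^ k)" for x y :: "nat \<Rightarrow> 'm"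
  by (rule summable_seq_dist[OF compact_symbols c_gt_1])

text \<open>
  Coordinates are continuous for \<open>d\<close>, which gives one half of the comparison of topologies below.
\<close>

lemma dist_coordinate_le: "dist (x k) (y k) \<le> c ^ k * d x y"
proof -
  have "dist (x k) (y k) / c ^ k = (\<Sum>i\<in>{k}. dist (x i) (y i) / c ^ i)" by simp
  also have "\<dots> \<le> d x y"
    unfolding seq_dist_def using c_gt_1 by (intro sum_le_suminf summable_d) auto
  finally show ?thesis using c_gt_1 by (simp add: field_simps)
qed

lemma d_prepend: "d (case_nat a x) (case_nat b y) = dist a b + d x y / c"
proof -
  have "d (case_nat a x) (case_nat b y) = (\<Sum>k. dist (x k) (y k) / c ^ Suc k) + dist a b"
    unfolding seq_dist_def
    using suminf_split_head[OF summable_d[of "case_nat a x" "case_nat b y"]] by simp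
  also have "(\<Sum>k. dist (x k) (y k) / c ^ Suc k) = (\<Sum>k. dist (x k) (y k) / c ^ k / c)"
    by (simp add: field_simps)
  also have "\<dots> = d x y / c"
    unfolding seq_dist_def by (rule suminf_divide[OF summable_d])
  finally show ?thesis by simp
qed

text \<open>
  The series of \<open>d\<close> converges uniformly because the compact space of symbols is bounded. The
  continuity refers to the product topology, which gives the other half.
\<close>

lemma continuous_on_d: "continuous_on UNIV (d x)"
proof -
  obtain B where B: "dist u v \<le> B" for u v :: 'm
    using compact_imp_bounded[OF compact_symbols] by (metis UNIV_I bounded_two_points)
  have "uniform_limit UNIV (\<lambda>n y. \<Sum>k<n. dist (x k) (y k) / c ^ k) (d x) sequentially"
    unfolding seq_dist_def
  proof (rule Weierstrass_m_test)
    show "summable (\<lambda>k. B * (1 / c) ^ k)"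
      using c_gt_1 by (intro summable_mult summable_geometric) simp
    show "norm (dist (x k) (y k) / c ^ k) \<le> B * (1 / c) ^ k" for k y
      using c_gt_1 B[of "x k" "y k"] by (simp add: power_one_over divide_right_mono flip: divide_inverse)
  qed
  moreover have "continuous_on UNIV (\<lambda>y. \<Sum>k<n. dist (x k) (y k) / c ^ k)" for n
    using c_gt_1 by (intro continuous_intros continuous_on_product_coordinates) auto
  ultimately show ?thesis
    by (intro uniform_limit_theorem[where F = sequentially]) auto
qed

text \<open>
  Identifying the topology of \<open>d\<close> with the product topology, which is the type class topology of
  \<open>nat \<Rightarrow> 'm\<close>, makes Tychonoff's theorem and the results on \<open>continuous_on\<close> available for \<open>C\<^sup>0\<close>.
\<close>

lemma mtopology_d: "d.mtopology = euclidean"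
proof -
  have "openin d.mtopology U \<longleftrightarrow> openin euclidean U" for U
  proof
    assume U: "openin d.mtopology U"
    have "\<exists>T. open T \<and> x \<in> T \<and> T \<subseteq> U" if x: "x \<in> U" for x
    proof -
      obtain r where r: "r > 0" "d.mball x r \<subseteq> U"
        using U x unfolding d.openin_mtopology by blast
      have "open (d x -` {..<r})"
        by (intro open_vimage continuous_on_d) simp
      moreover have "d x -` {..<r} = d.mball x r" by auto
      ultimately show ?thesis using r by (metis d.centre_in_mball_iff UNIV_I)
    qed
    then show "openin euclidean U" by (simp add: open_subopen[of U] open_openin[symmetric])
  next
    assume U: "openin euclidean U"
    have "continuous_map d.mtopology (product_topology (\<lambda>_. euclidean) UNIV) (id :: (nat \<Rightarrow> 'm) \<Rightarrow> _)"
      unfolding continuous_map_componentwise_UNIV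
    proof
      fix k
      have "openin d.mtopology {x. x k \<in> V}" if V: "open V" for V
        unfolding d.openin_mtopology
      proof (intro conjI allI impI)
        fix x assume "x \<in> {x. x k \<in> V}"
        then obtain e where e: "e > 0" "\<And>b. dist b (x k) < e \<Longrightarrow> b \<in> V"
          using V unfolding open_dist by blast
        have "d.mball x (e / c ^ k) \<subseteq> {x. x k \<in> V}"
        proof
          fix y assume "y \<in> d.mball x (e / c ^ k)"
          then have "c ^ k * d x y < e" using c_gt_1 by (simp add: field_simps)
          then show "y \<in> {x. x k \<in> V}"
            using dist_coordinate_le[of x k y] e(2)[of "y k"] by (simp add: dist_commute)
        qed
        then show "\<exists>r>0. d.mball x r \<subseteq> {x. x k \<in> V}"
          using e(1) c_gt_1 by (intro exI[of _ "e / c ^ k"]) auto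
      qed simp
      then show "continuous_map d.mtopology euclidean (\<lambda>x. (id x :: nat \<Rightarrow> 'm) k)"
        by (auto simp: continuous_map_def)
    qed
    then show "openin d.mtopology U"
      using openin_continuous_map_preimage[of d.mtopology euclidean id U] U
      by (simp add: euclidean_product_topology)
  qed
  then show ?thesis by (simp add: topology_eq)
qed

lemma compact_sequences: "compact (UNIV :: (nat \<Rightarrow> 'm) set)"
proof -
  have "compact_space (euclidean :: 'm topology)"
    using compact_symbols by (simp add: compact_space_def)
  then have "compact_space (product_topology (\<lambda>_::nat. euclidean :: 'm topology) UNIV)"
    by (simp add: compact_space_product_topology)
  then show ?thesis by (simp add: euclidean_product_topology compact_space_def)
qed

abbreviation bounded_fun :: "((nat \<Rightarrow> 'm) \<Rightarrow> real) \<Rightarrow> bool" where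
  "bounded_fun f \<equiv> bdd_above (range (\<lambda>x. \<bar>f x\<bar>))"

lemma abs_le_sup_norm: "bounded_fun f \<Longrightarrow> \<bar>f x\<bar> \<le> sup_norm f"
  unfolding sup_norm_def by (rule cSUP_upper) auto

lemma sup_norm_le: "(\<And>x. \<bar>f x\<bar> \<le> K) \<Longrightarrow> sup_norm f \<le> K" for f :: "(nat \<Rightarrow> 'm) \<Rightarrow> real"
  unfolding sup_norm_def by (rule cSUP_least) auto

lemma sup_norm_nonneg: "bounded_fun f \<Longrightarrow> 0 \<le> sup_norm f"
  using abs_le_sup_norm[of f undefined] by simp

lemma continuous_imp_bounded_fun:
  assumes "continuous_on UNIV f"
  shows "bounded_fun f"
proof -
  have "bounded (range f)"
    by (intro compact_imp_bounded compact_continuous_image[OF assms compact_sequences])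
  then obtain B where "\<bar>f x\<bar> \<le> B" for x
    by (auto simp: bounded_iff)
  then show ?thesis by (intro bdd_aboveI2[where M = B])
qed


section \<open>The Hoelder spaces are function algebras\<close>

abbreviation H :: "real \<Rightarrow> ((nat \<Rightarrow> 'm) \<Rightarrow> real) nspace" where
  "H \<equiv> Holder_space c"

lemma pts_H0: "f \<in> pts (H 0) \<longleftrightarrow> continuous_on UNIV f"
  by (simp add: Holder_space_def mtopology_d)

lemma nrm_H0: "nrm (H 0) f = sup_norm f"
  by (simp add: Holder_space_def)

text \<open>
  Closure under series is the Weierstrass M-test with the bounds \<open>sup_norm (F n)\<close>.
\<close>

lemma function_algebra_H0: "function_algebra (H 0)"
proof
  note bf = continuous_imp_bounded_fun
  fix f g :: "(nat \<Rightarrow> 'm) \<Rightarrow> real" and r :: real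
  show "1 \<in> pts (H 0)" by (simp add: pts_H0 one_fun_def)
  show "nrm (H 0) 1 \<le> 1" by (simp add: nrm_H0 sup_norm_le)
  { assume "f \<in> pts (H 0)"
    then have f: "continuous_on UNIV f" by (simp add: pts_H0)
    show "r *\<^sub>R f \<in> pts (H 0)"
      unfolding pts_H0 scaleR_fun_def by (intro continuous_intros f)
    show "nrm (H 0) (r *\<^sub>R f) \<le> \<bar>r\<bar> * nrm (H 0) f"
      unfolding nrm_H0
      by (intro sup_norm_le) (simp add: abs_mult mult_left_mono abs_le_sup_norm bf f)
    assume "g \<in> pts (H 0)"
    then have g: "continuous_on UNIV g" by (simp add: pts_H0)
    show "f + g \<in> pts (H 0)" "f * g \<in> pts (H 0)"
      unfolding pts_H0 plus_fun_def times_fun_def by (intro continuous_intros f g)+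
    show "nrm (H 0) (f + g) \<le> nrm (H 0) f + nrm (H 0) g"
      unfolding nrm_H0
    proof (rule sup_norm_le)
      show "\<bar>(f + g) x\<bar> \<le> sup_norm f + sup_norm g" for x
        using abs_le_sup_norm[OF bf[OF f], of x] abs_le_sup_norm[OF bf[OF g], of x] by simp
    qed
    show "nrm (H 0) (f * g) \<le> nrm (H 0) f * nrm (H 0) g"
      unfolding nrm_H0
      by (intro sup_norm_le)
         (simp add: abs_mult mult_mono abs_le_sup_norm sup_norm_nonneg bf f g) }
  fix F :: "nat \<Rightarrow> (nat \<Rightarrow> 'm) \<Rightarrow> real"
  assume "\<And>n. F n \<in> pts (H 0)" and "summable (\<lambda>n. nrm (H 0) (F n))"
    and sums: "\<And>x. (\<lambda>n. F n x) sums g x"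
  then have F: "\<And>n. continuous_on UNIV (F n)" and summ: "summable (\<lambda>n. sup_norm (F n))"
    by (simp_all add: pts_H0 nrm_H0)
  have le: "norm (F n x) \<le> sup_norm (F n)" for n x
    by (simp add: abs_le_sup_norm bf F)
  have "uniform_limit UNIV (\<lambda>n x. \<Sum>i<n. F i x) (\<lambda>x. \<Sum>i. F i x) sequentially"
    by (rule Weierstrass_m_test[OF le summ])
  moreover have "(\<lambda>x. \<Sum>i. F i x) = g"
    using sums by (simp add: fun_eq_iff sums_unique[symmetric])
  moreover have "continuous_on UNIV (\<lambda>x. \<Sum>i<n. F i x)" for n
    by (intro continuous_intros F)
  ultimately show "g \<in> pts (H 0)"
    unfolding pts_H0 by (intro uniform_limit_theorem[where F = sequentially]) auto
  have "norm (g x) \<le> (\<Sum>n. sup_norm (F n))" for x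
    using abs_sums_le[OF sums _ summ] le by simp
  then show "nrm (H 0) g \<le> (\<Sum>n. nrm (H 0) (F n))"
    by (simp add: nrm_H0 sup_norm_le)
qed


abbreviation Hol :: "real \<Rightarrow> ((nat \<Rightarrow> 'm) \<Rightarrow> real) \<Rightarrow> real" where
  "Hol \<equiv> Holder_const c"

abbreviation is_Holder :: "real \<Rightarrow> ((nat \<Rightarrow> 'm) \<Rightarrow> real) \<Rightarrow> bool" where
  "is_Holder \<gamma> f \<equiv> bdd_above (Holder_quotients c \<gamma> f)"

lemma Hol_nonneg: "is_Holder \<gamma> f \<Longrightarrow> 0 \<le> Hol \<gamma> f"
  unfolding Holder_const_def by (intro cSup_upper) auto

text \<open>
  The next two lemmas replace the supremum over quotients by the inequality that it encodes. On the
  diagonal both sides are \<open>0\<close>, so no case distinction on \<open>x \<noteq> y\<close> is left to the users.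
\<close>

lemma Hol_bound:
  assumes "is_Holder \<gamma> f"
  shows "\<bar>f y - f x\<bar> \<le> Hol \<gamma> f * d x y powr \<gamma>"
proof (cases "x = y")
  case False
  then have "\<bar>f y - f x\<bar> / d x y powr \<gamma> \<le> Hol \<gamma> f"
    unfolding Holder_const_def using assms
    by (intro cSup_upper) (auto simp: Holder_quotients_def)
  then show ?thesis
    using False d.mdist_pos_eq[of x y] by (simp add: field_simps)
qed (simp add: Hol_nonneg[OF assms])

lemma HolI:
  assumes "\<And>x y. \<bar>f y - f x\<bar> \<le> K * d x y powr \<gamma>" "0 \<le> K"
  shows is_HolderI: "is_Holder \<gamma> f" and Hol_le: "Hol \<gamma> f \<le> K"
proof -
  have q: "q \<le> K" if q: "q \<in> Holder_quotients c \<gamma> f" for q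
  proof -
    obtain x y where xy: "x \<noteq> y" "q = \<bar>f y - f x\<bar> / d x y powr \<gamma>"
      using q by (auto simp: Holder_quotients_def)
    then show ?thesis
      using assms(1)[of y x] d.mdist_pos_eq[of x y] by (simp add: pos_divide_le_eq)
  qed
  then show "is_Holder \<gamma> f"
    unfolding bdd_above_def by blast
  show "Hol \<gamma> f \<le> K"
    unfolding Holder_const_def using q assms(2) by (intro cSup_least) auto
qed

text \<open>
  Continuity supplies boundedness, by compactness, and measurability of the integrands below.
\<close>

lemma Holder_continuous:
  assumes f: "is_Holder \<gamma> f" and "\<gamma> > 0"
  shows "continuous_on UNIV f"
proof (rule continuous_on_sequentiallyI)
  fix u :: "nat \<Rightarrow> nat \<Rightarrow> 'm" and a assume u: "u \<longlonglongrightarrow> a"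
  have "isCont (d a) a"
    using continuous_on_d[of a] by (simp add: continuous_on_eq_continuous_at)
  then have "(\<lambda>n. d a (u n)) \<longlonglongrightarrow> d a a"
    by (rule isCont_tendsto_compose[OF _ u])
  then have "(\<lambda>n. d a (u n) powr \<gamma>) \<longlonglongrightarrow> 0 powr \<gamma>"
    using \<open>\<gamma> > 0\<close> by (intro tendsto_powr' tendsto_const) auto
  then have "(\<lambda>n. Hol \<gamma> f * d a (u n) powr \<gamma>) \<longlonglongrightarrow> 0"
    by (intro tendsto_mult_right_zero) simp
  then have "(\<lambda>n. f (u n) - f a) \<longlonglongrightarrow> 0"
    by (rule Lim_null_comparison[rotated]) (simp add: Hol_bound[OF f])
  then show "(\<lambda>n. f (u n)) \<longlonglongrightarrow> f a"
    by (simp add: LIM_zero_iff)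
qed

lemma Holder_bounded_fun: "\<lbrakk>is_Holder \<gamma> f; \<gamma> > 0\<rbrakk> \<Longrightarrow> bounded_fun f"
  by (intro continuous_imp_bounded_fun Holder_continuous)

lemma pts_H: "\<gamma> > 0 \<Longrightarrow> f \<in> pts (H \<gamma>) \<longleftrightarrow> is_Holder \<gamma> f"
  by (simp add: Holder_space_def)

lemma nrm_H: "\<gamma> > 0 \<Longrightarrow> nrm (H \<gamma>) f = sup_norm f + Hol \<gamma> f"
  by (simp add: Holder_space_def)

text \<open>
  The Hoelder constant satisfies the Leibniz estimate
  \<open>Hol(fg) \<le> |f|\<^sub>0 Hol(g) + |g|\<^sub>0 Hol(f)\<close>, so that
  \<open>|fg|\<^sub>0 + Hol(fg) \<le> (|f|\<^sub>0 + Hol(f)) (|g|\<^sub>0 + Hol(g))\<close>. For a series, the sup norm and the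
  Hoelder constant are summable separately and both are countably subadditive under pointwise sums.
\<close>

lemma function_algebra_H:
  assumes \<gamma>: "\<gamma> > 0"
  shows "function_algebra (H \<gamma>)"
proof
  note sup = abs_le_sup_norm[OF Holder_bounded_fun[OF _ \<gamma>]]
  note sup0 = sup_norm_nonneg[OF Holder_bounded_fun[OF _ \<gamma>]]
  note pts = pts_H[OF \<gamma>] and nrm = nrm_H[OF \<gamma>]
  fix f g :: "(nat \<Rightarrow> 'm) \<Rightarrow> real" and r :: real
  have one: "\<bar>(1::(nat \<Rightarrow> 'm) \<Rightarrow> real) y - 1 x\<bar> \<le> 0 * d x y powr \<gamma>" for x y
    by simp
  show "1 \<in> pts (H \<gamma>)"
    unfolding pts by (rule is_HolderI[OF one order_refl])
  have "Hol \<gamma> 1 \<le> 0"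
    by (rule Hol_le[OF one order_refl])
  then show "nrm (H \<gamma>) 1 \<le> 1"
    unfolding nrm using sup_norm_le[of 1 1] by simp
  { assume "f \<in> pts (H \<gamma>)"
    then have f: "is_Holder \<gamma> f" by (simp add: pts)
    have scale: "\<bar>(r *\<^sub>R f) y - (r *\<^sub>R f) x\<bar> \<le> (\<bar>r\<bar> * Hol \<gamma> f) * d x y powr \<gamma>" for x y
    proof -
      have "\<bar>(r *\<^sub>R f) y - (r *\<^sub>R f) x\<bar> = \<bar>r\<bar> * \<bar>f y - f x\<bar>"
        by (simp add: abs_mult flip: right_diff_distrib)
      also have "\<dots> \<le> \<bar>r\<bar> * (Hol \<gamma> f * d x y powr \<gamma>)"
        by (intro mult_left_mono Hol_bound f) simp
      finally show ?thesis by simp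
    qed
    have scale0: "0 \<le> \<bar>r\<bar> * Hol \<gamma> f" by (simp add: Hol_nonneg f)
    show "r *\<^sub>R f \<in> pts (H \<gamma>)"
      unfolding pts by (rule is_HolderI[OF scale scale0])
    have "sup_norm (r *\<^sub>R f) \<le> \<bar>r\<bar> * sup_norm f"
      by (intro sup_norm_le) (simp add: abs_mult mult_left_mono sup f)
    then show "nrm (H \<gamma>) (r *\<^sub>R f) \<le> \<bar>r\<bar> * nrm (H \<gamma>) f"
      unfolding nrm using Hol_le[where f = "r *\<^sub>R f", OF scale scale0] by (simp add: distrib_left)
    assume "g \<in> pts (H \<gamma>)"
    then have g: "is_Holder \<gamma> g" by (simp add: pts)
    have add: "\<bar>(f + g) y - (f + g) x\<bar> \<le> (Hol \<gamma> f + Hol \<gamma> g) * d x y powr \<gamma>" for x y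
      using Hol_bound[OF f, of y x] Hol_bound[OF g, of y x] by (simp add: distrib_right)
    have add0: "0 \<le> Hol \<gamma> f + Hol \<gamma> g" by (simp add: Hol_nonneg f g)
    show "f + g \<in> pts (H \<gamma>)"
      unfolding pts by (rule is_HolderI[OF add add0])
    have "sup_norm (f + g) \<le> sup_norm f + sup_norm g"
    proof (rule sup_norm_le)
      show "\<bar>(f + g) x\<bar> \<le> sup_norm f + sup_norm g" for x
        using sup[OF f, of x] sup[OF g, of x] by simp
    qed
    then show "nrm (H \<gamma>) (f + g) \<le> nrm (H \<gamma>) f + nrm (H \<gamma>) g"
      unfolding nrm using Hol_le[where f = "f + g", OF add add0] by simp
    have mult: "\<bar>(f * g) y - (f * g) x\<bar>
        \<le> (sup_norm f * Hol \<gamma> g + sup_norm g * Hol \<gamma> f) * d x y powr \<gamma>" for x y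
    proof -
      have "(f * g) y - (f * g) x = f y * (g y - g x) + g x * (f y - f x)"
        by (simp add: algebra_simps)
      also have "\<bar>\<dots>\<bar> \<le> \<bar>f y\<bar> * \<bar>g y - g x\<bar> + \<bar>g x\<bar> * \<bar>f y - f x\<bar>"
        using abs_triangle_ineq by (simp flip: abs_mult)
      also have "\<dots> \<le> sup_norm f * (Hol \<gamma> g * d x y powr \<gamma>) + sup_norm g * (Hol \<gamma> f * d x y powr \<gamma>)"
        by (intro add_mono mult_mono Hol_bound sup sup0 f g) auto
      finally show ?thesis by (simp add: algebra_simps)
    qed
    have mult0: "0 \<le> sup_norm f * Hol \<gamma> g + sup_norm g * Hol \<gamma> f"
      by (simp add: Hol_nonneg sup0 f g)
    show "f * g \<in> pts (H \<gamma>)"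
      unfolding pts by (rule is_HolderI[OF mult mult0])
    have "sup_norm (f * g) \<le> sup_norm f * sup_norm g"
      by (intro sup_norm_le) (simp add: abs_mult mult_mono sup sup0 f g)
    moreover have "0 \<le> Hol \<gamma> f * Hol \<gamma> g" by (simp add: Hol_nonneg f g)
    ultimately show "nrm (H \<gamma>) (f * g) \<le> nrm (H \<gamma>) f * nrm (H \<gamma>) g"
      unfolding nrm using Hol_le[where f = "f * g", OF mult mult0] by (simp add: algebra_simps) }
  fix F :: "nat \<Rightarrow> (nat \<Rightarrow> 'm) \<Rightarrow> real"
  assume "\<And>n. F n \<in> pts (H \<gamma>)" and "summable (\<lambda>n. nrm (H \<gamma>) (F n))"
    and sums: "\<And>x. (\<lambda>n. F n x) sums g x"
  then have F: "\<And>n. is_Holder \<gamma> (F n)" and summ: "summable (\<lambda>n. sup_norm (F n) + Hol \<gamma> (F n))"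
    by (simp_all add: pts nrm)
  have summ_sup: "summable (\<lambda>n. sup_norm (F n))" and summ_Hol: "summable (\<lambda>n. Hol \<gamma> (F n))"
    by (rule summable_comparison_test'[OF summ, of 0]; simp add: sup0 Hol_nonneg F)+
  have series: "\<bar>g y - g x\<bar> \<le> (\<Sum>n. Hol \<gamma> (F n)) * d x y powr \<gamma>" for x y
    using abs_sums_le[OF sums_diff[OF sums sums] Hol_bound[OF F] summable_mult2[OF summ_Hol]]
    by (simp add: suminf_mult2[OF summ_Hol])
  have series0: "0 \<le> (\<Sum>n. Hol \<gamma> (F n))"
    by (intro suminf_nonneg summ_Hol Hol_nonneg F)
  show "g \<in> pts (H \<gamma>)"
    unfolding pts by (rule is_HolderI[OF series series0])
  have "sup_norm g \<le> (\<Sum>n. sup_norm (F n))"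
    by (intro sup_norm_le abs_sums_le[OF sums sup[OF F] summ_sup])
  then show "nrm (H \<gamma>) g \<le> (\<Sum>n. nrm (H \<gamma>) (F n))"
    unfolding nrm using Hol_le[OF series series0] suminf_add[OF summ_sup summ_Hol] by simp
qed


section \<open>The transfer operator\<close>

definition transfer :: "((nat \<Rightarrow> 'm) \<Rightarrow> real) \<Rightarrow> (nat \<Rightarrow> 'm) \<Rightarrow> real" where
  "transfer f x = (\<integral>a. f (case_nat a x) \<partial>\<mu>)"

definition total_mass :: real where
  "total_mass = measure \<mu> (space \<mu>)"

lemma total_mass_nonneg: "0 \<le> total_mass"
  by (simp add: total_mass_def)

lemma measurable_prepend:
  fixes f :: "(nat \<Rightarrow> 'm) \<Rightarrow> real"
  assumes "continuous_on UNIV f"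
  shows "(\<lambda>a. f (case_nat a x)) \<in> borel_measurable \<mu>"
proof -
  have "continuous_on UNIV (\<lambda>a. case_nat a x k)" for k
    by (cases k) (auto intro: continuous_intros)
  then have "continuous_on UNIV (\<lambda>a. case_nat a x)"
    by (rule continuous_on_coordinatewise_then_product)
  then have "continuous_on UNIV (\<lambda>a. f (case_nat a x))"
    by (rule continuous_on_compose2[OF assms]) auto
  then have "(\<lambda>a. f (case_nat a x)) \<in> borel_measurable borel"
    by (rule borel_measurable_continuous_onI)
  then show ?thesis
    using measurable_cong_sets[OF sets_eq_borel refl] by blast
qed

lemma integrable_prepend:
  fixes f :: "(nat \<Rightarrow> 'm) \<Rightarrow> real"
  assumes f: "continuous_on UNIV f"
  shows "integrable \<mu> (\<lambda>a. f (case_nat a x))"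
  by (rule integrable_const_bound[where B = "sup_norm f"])
     (simp_all add: abs_le_sup_norm continuous_imp_bounded_fun f measurable_prepend)

lemma abs_integral_le:
  fixes h :: "'m \<Rightarrow> real"
  assumes "integrable \<mu> h" "\<And>a. \<bar>h a\<bar> \<le> K"
  shows "\<bar>\<integral>a. h a \<partial>\<mu>\<bar> \<le> total_mass * K"
proof -
  have "\<bar>\<integral>a. h a \<partial>\<mu>\<bar> \<le> (\<integral>a. \<bar>h a\<bar> \<partial>\<mu>)"
    by (rule integral_abs_bound)
  also have "\<dots> \<le> (\<integral>a. K \<partial>\<mu>)"
    using assms by (intro integral_mono) auto
  finally show ?thesis by (simp add: total_mass_def)
qed

lemma sup_norm_transfer_le:
  assumes f: "continuous_on UNIV f"
  shows "sup_norm (transfer f) \<le> total_mass * sup_norm f"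
  unfolding transfer_def
  by (intro sup_norm_le abs_integral_le integrable_prepend f abs_le_sup_norm
      continuous_imp_bounded_fun)

lemma transfer_add:
  "\<lbrakk>continuous_on UNIV f; continuous_on UNIV g\<rbrakk> \<Longrightarrow> transfer (f + g) = transfer f + transfer g"
  by (simp add: transfer_def fun_eq_iff integrable_prepend)

lemma transfer_scaleR: "transfer (r *\<^sub>R f) = r *\<^sub>R transfer f"
  by (simp add: transfer_def fun_eq_iff)

text \<open>
  Dominated convergence: prepending a fixed symbol is continuous and \<open>f\<close> is bounded.
\<close>

lemma continuous_transfer:
  assumes f: "continuous_on UNIV f"
  shows "continuous_on UNIV (transfer f)"
proof (rule continuous_on_sequentiallyI)
  fix u :: "nat \<Rightarrow> nat \<Rightarrow> 'm" and x assume u: "u \<longlonglongrightarrow> x"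
  show "(\<lambda>n. transfer f (u n)) \<longlonglongrightarrow> transfer f x"
    unfolding transfer_def
  proof (rule integral_dominated_convergence[where w = "\<lambda>_. sup_norm f"])
    show "AE a in \<mu>. (\<lambda>n. f (case_nat a (u n))) \<longlonglongrightarrow> f (case_nat a x)"
    proof (rule AE_I2)
      fix a :: 'm
      have "continuous_on UNIV (\<lambda>x. case_nat a x k)" for k
        by (cases k) (auto intro: continuous_intros continuous_on_product_coordinates)
      then have "continuous_on UNIV (\<lambda>x. case_nat a x)"
        by (rule continuous_on_coordinatewise_then_product)
      then have "continuous_on UNIV (\<lambda>x. f (case_nat a x))"
        by (rule continuous_on_compose2[OF f]) auto
      then have "isCont (\<lambda>x. f (case_nat a x)) x"
        by (simp add: continuous_on_eq_continuous_at)
      then show "(\<lambda>n. f (case_nat a (u n))) \<longlonglongrightarrow> f (case_nat a x)"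
        by (rule isCont_tendsto_compose[OF _ u])
    qed
  qed (simp_all add: measurable_prepend abs_le_sup_norm continuous_imp_bounded_fun f)
qed

text \<open>
  Prepending a common symbol divides distances by \<open>c > 1\<close>, so the Hoelder constants do not grow
  apart from the factor \<open>total_mass\<close> that comes from the integration.
\<close>

lemma Holder_transfer:
  assumes f: "is_Holder \<gamma> f" and \<gamma>: "\<gamma> > 0"
  shows is_Holder_transfer: "is_Holder \<gamma> (transfer f)"
    and Hol_transfer_le: "Hol \<gamma> (transfer f) \<le> total_mass * Hol \<gamma> f"
proof -
  note i = integrable_prepend[OF Holder_continuous[OF f \<gamma>]]
  have *: "\<bar>transfer f y - transfer f x\<bar> \<le> (total_mass * Hol \<gamma> f) * d x y powr \<gamma>" for x y
  proof -
    have "\<bar>\<integral>a. f (case_nat a y) - f (case_nat a x) \<partial>\<mu>\<bar> \<le> total_mass * (Hol \<gamma> f * d x y powr \<gamma>)"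
    proof (rule abs_integral_le)
      fix a
      have "\<bar>f (case_nat a y) - f (case_nat a x)\<bar> \<le> Hol \<gamma> f * (d x y / c) powr \<gamma>"
        using Hol_bound[OF f, of "case_nat a y" "case_nat a x"] by (simp add: d_prepend)
      also have "\<dots> \<le> Hol \<gamma> f * d x y powr \<gamma>"
        using c_gt_1 \<gamma> d.nonneg[of x y] mult_left_mono[of 1 c "d x y"]
        by (intro mult_left_mono powr_mono2 Hol_nonneg f) (auto simp: pos_divide_le_eq)
      finally show "\<bar>f (case_nat a y) - f (case_nat a x)\<bar> \<le> Hol \<gamma> f * d x y powr \<gamma>" .
    qed (intro Bochner_Integration.integrable_diff i)
    then show ?thesis
      by (simp add: transfer_def Bochner_Integration.integral_diff[OF i i] mult.assoc)
  qed
  have "0 \<le> total_mass * Hol \<gamma> f"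
    by (simp add: total_mass_nonneg Hol_nonneg f)
  then show "is_Holder \<gamma> (transfer f)" "Hol \<gamma> (transfer f) \<le> total_mass * Hol \<gamma> f"
    using is_HolderI[OF *] Hol_le[OF *] by auto
qed

lemma H_continuous: "\<lbrakk>f \<in> pts (H \<gamma>); 0 \<le> \<gamma>\<rbrakk> \<Longrightarrow> continuous_on UNIV f"
  by (cases "\<gamma> = 0") (auto simp: pts_H0 pts_H intro: Holder_continuous)

lemma weighted_operator_transfer:
  assumes "0 \<le> \<gamma>"
  shows "weighted_operator (H \<gamma>) transfer total_mass"
proof (intro weighted_operator.intro weighted_operator_axioms.intro)
  show "function_algebra (H \<gamma>)"
    using assms function_algebra_H0 function_algebra_H by (cases "\<gamma> = 0") auto
  fix f g r assume f: "f \<in> pts (H \<gamma>)"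
  note cf = H_continuous[OF f assms]
  show "transfer f \<in> pts (H \<gamma>)"
    using f assms by (cases "\<gamma> = 0") (auto simp: pts_H0 pts_H continuous_transfer is_Holder_transfer)
  show "transfer (f + g) = transfer f + transfer g" if "g \<in> pts (H \<gamma>)"
    by (intro transfer_add cf H_continuous[OF that assms])
  show "transfer (r *\<^sub>R f) = r *\<^sub>R transfer f"
    by (rule transfer_scaleR)
  show "nrm (H \<gamma>) (transfer f) \<le> total_mass * nrm (H \<gamma>) f"
  proof (cases "\<gamma> = 0")
    case True
    then show ?thesis by (simp add: nrm_H0 sup_norm_transfer_le cf)
  next
    case False
    then have \<gamma>: "\<gamma> > 0" using assms by simp
    then show ?thesis
      using sup_norm_transfer_le[OF cf] Hol_transfer_le[of \<gamma> f] f
      by (simp add: nrm_H pts_H distrib_left)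
  qed
qed (rule total_mass_nonneg)

lemma ruelle_eq_transfer: "ruelle \<mu> \<psi> \<phi> = transfer (expf \<psi> * \<phi>)"
  by (simp add: ruelle_def transfer_def expf_def fun_eq_iff)

end


theorem theorem3p5:
  fixes \<mu> :: "'m::metric_space measure" and c \<gamma> :: real
  assumes "compact (UNIV :: 'm set)"
    and "sets \<mu> = sets borel" and "finite_measure \<mu>"
    and "c > 1" and "0 \<le> \<gamma>" and "\<gamma> \<le> 1"
  shows "analytic_map (Holder_space c \<gamma>) (operator_space (Holder_space c \<gamma>))
           (pts (Holder_space c \<gamma>)) (Ruelle_map c \<gamma> \<mu>)"
proof -
  interpret ruelle_system \<mu> c
    using assms by (simp add: ruelle_system_def ruelle_system_axioms_def)
  interpret weighted_operator "Holder_space c \<gamma>" transfer total_mass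
    by (rule weighted_operator_transfer[OF \<open>0 \<le> \<gamma>\<close>])
  have "Ruelle_map c \<gamma> \<mu> = (\<lambda>\<psi>. weighted (expf \<psi>))"
    by (simp add: fun_eq_iff Ruelle_map_def weighted_def ruelle_eq_transfer extend_by_zero_def)
  then show ?thesis
    using analytic_weighted_exp by simp
qed

end
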